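(* Let $h:\mathbb{R}^n\to\mathbb{R}\cup\{+\infty\}$ be a proper function that is $\nu$-paraconvex on a convex set $S\subseteq\operatorname{dom}(h)$ with $\nu\in(0,1]$ and constant $\rho>0$. Then the following assertions hold: (a) the function $h$ is locally bounded on $\operatorname{int}S$; (b) the function $h$ is locally Lipschitz on $\operatorname{int}S$.
   Context: $\|\cdot\|$ is the Euclidean norm, $\operatorname{dom}(h)=\{x:h(x)<+\infty\}$, and $\operatorname{int}S$ is the interior of $S$; $h$ is proper if $\operatorname{dom}(h)\neq\emptyset$. For $0<\nu\le 1$, a proper function $h$ is called $\nu$-paraconvex on a convex set $S\subseteq\operatorname{dom}(h)$ with constant $\rho>0$ if for all $x,y\in S$ and $\lambda\in[0,1]$, $$h(\lambda x+(1-\lambda)y)\le\lambda h(x)+(1-\lambda)h(y)+\rho\min\{\lambda,1-\lambda\}\|x-y\|^{1+\nu}.$$ *)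

theory Defs
  imports "HOL-Analysis.Analysis"
begin

text \<open>
  Functions with values in the reals extended by plus infinity are rendered as functions into
  \<^typ>\<open>ereal\<close> that never take the value \<^term>\<open>-\<infinity> :: ereal\<close>.
\<close>

definition avoids_minus_infinity :: "('a \<Rightarrow> ereal) \<Rightarrow> bool" where
  "avoids_minus_infinity h \<longleftrightarrow> (\<forall>x. h x \<noteq> -\<infinity>)"

definition eff_dom :: "('a \<Rightarrow> ereal) \<Rightarrow> 'a set" where
  "eff_dom h = {x. h x < \<infinity>}"

definition proper_fun :: "('a \<Rightarrow> ereal) \<Rightarrow> bool" where
  "proper_fun h \<longleftrightarrow> eff_dom h \<noteq> {}"

text \<open>
  The standing conditions (\<open>0 < \<nu> \<le> 1\<close>, \<open>\<rho> > 0\<close>, \<open>h\<close> proper, \<open>S\<close> convex and contained in the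
  effective domain) are not part of this predicate; they are to be assumed separately.
\<close>

definition paraconvex_on ::
    "real \<Rightarrow> real \<Rightarrow> 'a::real_normed_vector set \<Rightarrow> ('a \<Rightarrow> ereal) \<Rightarrow> bool" where
  "paraconvex_on \<nu> \<rho> S h \<longleftrightarrow>
     (\<forall>x\<in>S. \<forall>y\<in>S. \<forall>l\<in>{0..1}.
        h (l *\<^sub>R x + (1 - l) *\<^sub>R y)
          \<le> ereal l * h x + ereal (1 - l) * h y
             + ereal (\<rho> * min l (1 - l) * norm (x - y) powr (1 + \<nu>)))"

definition locally_bounded_on :: "'a::metric_space set \<Rightarrow> ('a \<Rightarrow> ereal) \<Rightarrow> bool" where
  "locally_bounded_on A h \<longleftrightarrow>
     (\<forall>x\<in>A. \<exists>r>0. \<exists>M::real. \<forall>y\<in>ball x r \<inter> A. \<bar>h y\<bar> \<le> ereal M)"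

text \<open>
  Finiteness on \<open>A\<close> is demanded explicitly because \<^const>\<open>real_of_ereal\<close> sends both infinities to
  \<open>0\<close>.
\<close>

definition locally_lipschitz_on :: "'a::metric_space set \<Rightarrow> ('a \<Rightarrow> ereal) \<Rightarrow> bool" where
  "locally_lipschitz_on A h \<longleftrightarrow>
     (\<forall>x\<in>A. \<bar>h x\<bar> \<noteq> \<infinity>) \<and>
     (\<forall>x\<in>A. \<exists>r>0. \<exists>L. L-lipschitz_on (ball x r \<inter> A) (\<lambda>y. real_of_ereal (h y)))"

end

theory Submission
  imports Defs
begin

text \<open>
  Only local behaviour matters, and on a bounded set the error term
  \<open>\<rho> * min l (1 - l) * norm (x - y) powr (1 + \<nu>)\<close> is at most \<open>C * min l (1 - l)\<close> for a constant
  \<open>C\<close>. This weaker form of convexity suffices for the classical proof that a convex function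
  is locally Lipschitz.

  An upper bound: a polytope is built from its vertices by finitely many joins with a point,
  and each join raises an upper bound valid for both parts by at most \<open>C\<close>; every interior point
  has a box around it, which is such a polytope (lemma \<open>almost_convex_on_convex_hull_bounded_above\<close>). A lower
  bound: the centre of a ball is the midpoint of any point and its reflection, so an upper bound
  at the reflected point gives a lower bound at the point
  (lemma \<open>almost_convex_on_ball_locally_bounded\<close>).

  The Lipschitz estimate: prolong the segment from \<open>x\<close> to \<open>y\<close> by a fixed length \<open>r\<close> beyond \<open>y\<close>. The
  weight of the new end point is at most \<open>norm (y - x) / r\<close>, and since the error carries the
  factor \<open>min l (1 - l)\<close>, it is linear in that weight too
  (lemma \<open>almost_convex_on_ball_lipschitz\<close>).
\<close>

definition almost_convex_on :: "real \<Rightarrow> 'a::real_vector set \<Rightarrow> ('a \<Rightarrow> real) \<Rightarrow> bool" where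
  "almost_convex_on C T f \<longleftrightarrow>
     (\<forall>x\<in>T. \<forall>y\<in>T. \<forall>l\<in>{0..1}.
        f (l *\<^sub>R x + (1 - l) *\<^sub>R y) \<le> l * f x + (1 - l) * f y + C * min l (1 - l))"

lemma almost_convex_onD:
  assumes "almost_convex_on C T f" "x \<in> T" "y \<in> T" "0 \<le> l" "l \<le> 1"
  shows "f (l *\<^sub>R x + (1 - l) *\<^sub>R y) \<le> l * f x + (1 - l) * f y + C * min l (1 - l)"
  using assms unfolding almost_convex_on_def by auto

text \<open>
  Adding a vertex \<open>a\<close> replaces a polytope by the union of the segments from \<open>a\<close> to its points. Along
  such a segment the value is at most the larger bound plus \<open>C\<close>.
\<close>

lemma almost_convex_on_convex_hull_bounded_above:
  fixes f :: "'a::real_vector \<Rightarrow> real"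
  assumes ac: "almost_convex_on C T f" and C: "0 \<le> C"
    and "finite K" "convex hull K \<subseteq> T"
  shows "\<exists>M. \<forall>y\<in>convex hull K. f y \<le> M"
  using assms(3,4)
proof (induction K rule: finite_induct)
  case empty
  then show ?case by simp
next
  case (insert a K)
  show ?case
  proof (cases "K = {}")
    case True
    then show ?thesis by auto
  next
    case False
    have sub: "convex hull K \<subseteq> T"
      using insert.prems hull_mono[of K "insert a K" convex] by blast
    then obtain M where M: "\<And>y. y \<in> convex hull K \<Longrightarrow> f y \<le> M"
      using insert.IH by blast
    have aT: "a \<in> T"
      using insert.prems hull_inc[of a "insert a K" convex] by blast
    have "f y \<le> max (f a) M + C" if y: "y \<in> convex hull (insert a K)" for y
    proof -
      obtain u v b where uv: "0 \<le> u" "0 \<le> v" "u + v = 1"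
        and b: "b \<in> convex hull K" and y_eq: "y = u *\<^sub>R a + v *\<^sub>R b"
        using y unfolding convex_hull_insert[OF False] by blast
      have v: "v = 1 - u" using uv by simp
      have "f y \<le> u * f a + v * f b + C * min u v"
        using almost_convex_onD[OF ac aT, of b u] b sub uv unfolding y_eq v by auto
      also have "\<dots> \<le> u * max (f a) M + v * max (f a) M + C * 1"
        using uv M[OF b] C by (intro add_mono mult_left_mono) auto
      also have "\<dots> = max (f a) M + C"
        using uv by (simp flip: distrib_right)
      finally show ?thesis .
    qed
    then show ?thesis by blast
  qed
qed

text \<open>
  The upper bound comes from a box around the centre. The lower bound needs a set symmetric
  about \<open>x\<close>, hence the passage to a ball inside that box: it contains \<open>2 *\<^sub>R x - y\<close> along with
  \<open>y\<close>, and \<open>f x\<close> lies, up to \<open>C / 2\<close>, below the mean of the two values.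
\<close>

lemma almost_convex_on_ball_locally_bounded:
  fixes f :: "'a::euclidean_space \<Rightarrow> real"
  assumes ac: "almost_convex_on C (ball x R) f" and C: "0 \<le> C" and R: "0 < R"
  shows "\<exists>r>0. r \<le> R \<and> (\<exists>M. \<forall>y\<in>ball x r. \<bar>f y\<bar> \<le> M)"
proof -
  obtain a b where ab: "x \<in> box a b" "cbox a b \<subseteq> ball x R"
    by (rule open_contains_cbox[of "ball x R" x]) (use R in auto)
  obtain K where K: "finite K" "cbox a b = convex hull K"
    by (rule closed_interval_as_convex_hull)
  obtain M where M: "\<And>y. y \<in> cbox a b \<Longrightarrow> f y \<le> M"
    using almost_convex_on_convex_hull_bounded_above[OF ac C K(1)] ab(2) unfolding K(2) by blast
  obtain r where r: "0 < r" "ball x r \<subseteq> box a b"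
    using ab(1) openE[OF open_box] by blast
  have upper: "f y \<le> M" if "y \<in> ball x r" for y
    using that r(2) box_subset_cbox M by blast
  have rR: "ball x r \<subseteq> ball x R"
    using r(2) ab(2) box_subset_cbox by blast
  have "\<bar>f y\<bar> \<le> max M (M + C - 2 * f x)" if y: "y \<in> ball x r" for y
  proof -
    define z where "z = 2 *\<^sub>R x - y"
    have "x - z = y - x" unfolding z_def by (simp add: scaleR_2)
    then have z: "z \<in> ball x r" using y by (simp add: dist_norm norm_minus_commute)
    have mid: "(1/2) *\<^sub>R y + (1 - 1/2) *\<^sub>R z = x"
      unfolding z_def by (simp add: scaleR_diff_right)
    have "y \<in> ball x R" "z \<in> ball x R" using y z rR by auto
    from almost_convex_onD[OF ac this, of "1/2"]
    have "f x \<le> 1/2 * f y + 1/2 * f z + C / 2" unfolding mid by simp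
    with upper[OF y] upper[OF z] show ?thesis by linarith
  qed
  moreover have "r \<le> R"
    using rR r(1) by (simp add: ball_subset_ball_iff)
  ultimately show ?thesis using r(1) by blast
qed

text \<open>
  A segment between two points of the smaller ball, prolonged by \<open>r\<close>, still ends in the ball of twice
  the radius, where \<open>f\<close> is bounded. The increment of \<open>f\<close> over the short piece is then at most its
  proportion \<open>l\<close> of the whole segment times \<open>2 * M + C\<close>.
\<close>

lemma almost_convex_on_ball_lipschitz:
  fixes f :: "'a::real_normed_vector \<Rightarrow> real"
  assumes ac: "almost_convex_on C (ball c (2 * r)) f" and C: "0 \<le> C" and r: "0 < r"
    and M: "\<And>y. y \<in> ball c (2 * r) \<Longrightarrow> \<bar>f y\<bar> \<le> M"
  shows "((2 * M + C) / r)-lipschitz_on (ball c r) f"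
proof -
  have M0: "0 \<le> M" using M[of c] r by auto
  have one_sided: "f y - f x \<le> (2 * M + C) / r * dist x y"
    if x: "x \<in> ball c r" and y: "y \<in> ball c r" for x y
  proof (cases "x = y")
    case True
    then show ?thesis by simp
  next
    case False
    define d where "d = norm (y - x)"
    have d: "0 < d" using False by (simp add: d_def)
    define z where "z = y + (r / d) *\<^sub>R (y - x)"
    define l where "l = d / (d + r)"
    have l: "0 \<le> l" "l \<le> 1" using d r by (auto simp: l_def)
    have "norm (z - y) = r" using d r by (simp add: z_def flip: d_def)
    then have "dist c z < 2 * r"
      using dist_triangle[of c z y] y by (simp add: dist_norm norm_minus_commute)
    then have z: "z \<in> ball c (2 * r)" by simp
    have x2: "x \<in> ball c (2 * r)" using x r by simp
    have "l *\<^sub>R z + (1 - l) *\<^sub>R x = x + (l * (1 + r / d)) *\<^sub>R (y - x)"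
      unfolding z_def by (simp add: algebra_simps)
    also have "l * (1 + r / d) = 1"
    proof -
      have "1 + r / d = (d + r) / d" using d by (simp add: add_divide_distrib)
      with d r show ?thesis by (simp add: l_def)
    qed
    finally have y_eq: "l *\<^sub>R z + (1 - l) *\<^sub>R x = y" by simp
    have "f y \<le> l * f z + (1 - l) * f x + C * min l (1 - l)"
      using almost_convex_onD[OF ac z x2 l] unfolding y_eq .
    also have "\<dots> \<le> l * f z + (1 - l) * f x + C * l"
      using C by (intro add_left_mono mult_left_mono) auto
    finally have "f y - f x \<le> l * (f z - f x + C)" by (simp add: algebra_simps)
    also have "\<dots> \<le> l * (2 * M + C)"
      using M[OF z] M[OF x2] l by (intro mult_left_mono) auto
    also have "\<dots> \<le> (d / r) * (2 * M + C)"
      using d r M0 C unfolding l_def by (intro mult_right_mono divide_left_mono) auto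
    finally show ?thesis by (simp add: d_def dist_norm norm_minus_commute mult.commute)
  qed
  show ?thesis
  proof (rule lipschitz_onI)
    fix x y assume "x \<in> ball c r" "y \<in> ball c r"
    then show "dist (f x) (f y) \<le> (2 * M + C) / r * dist x y"
      using one_sided[of x y] one_sided[of y x]
      by (simp add: dist_real_def dist_commute abs_le_iff)
  qed (use M0 C r in auto)
qed

text \<open>
  On a ball of radius \<open>R\<close> inside \<open>S\<close>, distances are at most \<open>2 * R\<close>, which bounds the power of the
  norm; finiteness of \<open>h\<close> on \<open>S\<close> turns the extended inequality into a real one.
\<close>

lemma paraconvex_on_imp_almost_convex_on_ball:
  fixes h :: "'a::real_normed_vector \<Rightarrow> ereal"
  assumes pc: "paraconvex_on \<nu> \<rho> S h" and "convex S" and sub: "ball x R \<subseteq> S"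
    and fin: "\<And>y. y \<in> S \<Longrightarrow> \<bar>h y\<bar> \<noteq> \<infinity>" and \<rho>: "0 \<le> \<rho>" and \<nu>: "0 \<le> 1 + \<nu>"
  shows "almost_convex_on (\<rho> * (2 * R) powr (1 + \<nu>)) (ball x R) (\<lambda>y. real_of_ereal (h y))"
  unfolding almost_convex_on_def
proof (intro ballI)
  fix y z l assume y: "y \<in> ball x R" and z: "z \<in> ball x R" and l: "l \<in> {0..1::real}"
  define w where "w = l *\<^sub>R y + (1 - l) *\<^sub>R z"
  have wS: "w \<in> S"
    unfolding w_def using \<open>convex S\<close> y z l sub by (intro convexD) auto
  obtain p q s where h: "h y = ereal p" "h z = ereal q" "h w = ereal s"
    using fin[of y] fin[of z] fin[OF wS] y z sub
    by (cases "h y"; cases "h z"; cases "h w") (auto simp: subset_iff)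
  have "h w \<le> ereal l * h y + ereal (1 - l) * h z
      + ereal (\<rho> * min l (1 - l) * norm (y - z) powr (1 + \<nu>))"
    using pc y z l sub unfolding paraconvex_on_def w_def by blast
  then have "s \<le> l * p + (1 - l) * q + \<rho> * min l (1 - l) * norm (y - z) powr (1 + \<nu>)"
    by (simp add: h)
  also have "\<dots> \<le> l * p + (1 - l) * q + \<rho> * min l (1 - l) * (2 * R) powr (1 + \<nu>)"
  proof (intro add_left_mono mult_left_mono powr_mono2)
    show "norm (y - z) \<le> 2 * R"
      using dist_triangle[of y z x] y z by (simp add: dist_commute dist_norm[symmetric])
  qed (use \<rho> \<nu> l in auto)
  finally show "real_of_ereal (h (l *\<^sub>R y + (1 - l) *\<^sub>R z)) \<le> l * real_of_ereal (h y)
      + (1 - l) * real_of_ereal (h z) + \<rho> * (2 * R) powr (1 + \<nu>) * min l (1 - l)"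
    by (simp add: h mult_ac flip: w_def)
qed

theorem theorem3p8:
  fixes h :: "real ^ 'n \<Rightarrow> ereal" and S :: "(real ^ 'n) set" and \<nu> \<rho> :: real
  assumes "avoids_minus_infinity h"
    and "proper_fun h"
    and "0 < \<nu>" and "\<nu> \<le> 1"
    and "\<rho> > 0"
    and "convex S" and "S \<subseteq> eff_dom h"
    and "paraconvex_on \<nu> \<rho> S h"
  shows "locally_bounded_on (interior S) h \<and> locally_lipschitz_on (interior S) h"
proof -
  let ?f = "\<lambda>y. real_of_ereal (h y)"
  have fin: "\<bar>h y\<bar> \<noteq> \<infinity>" if "y \<in> S" for y
    using assms(1,7) that unfolding avoids_minus_infinity_def eff_dom_def by force
  have local: "\<exists>r>0. \<exists>M L. (\<forall>y\<in>ball x r \<inter> interior S. \<bar>h y\<bar> \<le> ereal M)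
      \<and> L-lipschitz_on (ball x r \<inter> interior S) ?f"
    if x: "x \<in> interior S" for x
  proof -
    obtain R where R: "0 < R" "ball x R \<subseteq> S"
      using x mem_interior by blast
    define C where "C = \<rho> * (2 * R) powr (1 + \<nu>)"
    have C: "0 \<le> C" using assms(5) by (simp add: C_def)
    have ac: "almost_convex_on C (ball x R) ?f"
      unfolding C_def using assms(3,5)
      by (intro paraconvex_on_imp_almost_convex_on_ball[OF assms(8,6) R(2) fin]) auto
    obtain r M where r: "0 < r" "r \<le> R" and M: "\<And>y. y \<in> ball x r \<Longrightarrow> \<bar>?f y\<bar> \<le> M"
      using almost_convex_on_ball_locally_bounded[OF ac C R(1)] by blast
    have "almost_convex_on C (ball x (2 * (r / 2))) ?f"
      using ac r(2) unfolding almost_convex_on_def by auto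
    then have "((2 * M + C) / (r / 2))-lipschitz_on (ball x (r / 2)) ?f"
      using r(1) M C by (intro almost_convex_on_ball_lipschitz) auto
    then have "((2 * M + C) / (r / 2))-lipschitz_on (ball x (r / 2) \<inter> interior S) ?f"
      by (rule lipschitz_on_subset) auto
    moreover have "\<bar>h y\<bar> \<le> ereal M" if "y \<in> ball x (r / 2) \<inter> interior S" for y
    proof -
      have "y \<in> S" using that interior_subset by blast
      then obtain t where "h y = ereal t" using fin by fastforce
      with M[of y] that r(1) show ?thesis by auto
    qed
    moreover have "0 < r / 2" using r(1) by simp
    ultimately show ?thesis
      by (intro exI[of _ "r / 2"] exI[of _ M] exI[of _ "(2 * M + C) / (r / 2)"] conjI ballI)
  qed
  show ?thesis
    unfolding locally_bounded_on_def locally_lipschitz_on_def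
  proof (intro conjI ballI)
    show "\<bar>h x\<bar> \<noteq> \<infinity>" if "x \<in> interior S" for x
      by (rule fin) (use that interior_subset in auto)
  next
    fix x assume "x \<in> interior S"
    from local[OF this] show "\<exists>r>0. \<exists>M. \<forall>y\<in>ball x r \<inter> interior S. \<bar>h y\<bar> \<le> ereal M"
      by blast
  next
    fix x assume "x \<in> interior S"
    from local[OF this] show "\<exists>r>0. \<exists>L. L-lipschitz_on (ball x r \<inter> interior S) ?f"
      by blast
  qed
qed

end
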